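(* Consider the random graph mixture model with $r=2$ node states on $n\ge 16$ nodes. Its parameters $(\pi_1,\pi_2,p_{11},p_{12},p_{22})$ are strictly identifiable, up to label swapping, provided the connection parameters $p_{11},p_{12},p_{22}$ are distinct. That is, if $\theta=(\pi_1,\pi_2,p_{11},p_{12},p_{22})$ is a parameter of the model with $p_{11},p_{12},p_{22}$ pairwise distinct, and $\theta'=(\pi_1',\pi_2',p_{11}',p_{12}',p_{22}')$ is a parameter of the model giving the same joint distribution of the edge indicators $(X_{ij})_{1\le i<j\le n}$, then either $\theta'=\theta$ or $\theta'=(\pi_2,\pi_1,p_{22},p_{12},p_{11})$.
   Context: Random graph mixture model with $r$ node states on $n$ nodes: consider an undirected graph with nodes $1,\dots,n$, where the presence/absence of an edge between distinct nodes $i,j$ is given by the indicator variable $X_{ij}=X_{ji}\in\{0,1\}$. The node classes $Z_1,\dots,Z_n$ are unobserved i.i.d. random variables with values in $\{1,\dots,r\}$ and distribution $\boldsymbol\pi=(\pi_1,\dots,\pi_r)\in(0,1)^r$, $\sum_i\pi_i=1$. Conditional on $(Z_1,\dots,Z_n)$, the variables $X_{ij}$, $1\le i<j\le n$, are independent and $X_{ij}$ is Bernoulli with parameter $p_{Z_iZ_j}=\mathbb P(X_{ij}=1\mid Z_i,Z_j)$, where the connection parameters $p_{ab}\in[0,1]$ satisfy $p_{ab}=p_{ba}$ for all $1\le a,b\le r$. Only the $X_{ij}$ are observed. For $r=2$ the parameters are $\pi_1,\pi_2\in(0,1)$ with $\pi_1+\pi_2=1$ and $p_{11},p_{12}=p_{21},p_{22}\in[0,1]$.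 *)

theory Defs
  imports "HOL-Probability.Probability"
begin

definition mixture_param :: "nat \<Rightarrow> (nat \<Rightarrow> real) \<Rightarrow> (nat \<Rightarrow> nat \<Rightarrow> real) \<Rightarrow> bool" where
  "mixture_param r \<pi> p \<longleftrightarrow>
     (\<forall>a\<in>{1..r}. 0 < \<pi> a \<and> \<pi> a < 1) \<and> (\<Sum>a=1..r. \<pi> a) = 1 \<and>
     (\<forall>a\<in>{1..r}. \<forall>b\<in>{1..r}. 0 \<le> p a b \<and> p a b \<le> 1 \<and> p a b = p b a)"

(* Meaningful only when \<pi> is a probability vector on {1..r}; see pmf_node_state_pmf. *)
definition node_state_pmf :: "nat \<Rightarrow> (nat \<Rightarrow> real) \<Rightarrow> nat pmf" where
  "node_state_pmf r \<pi> = embed_pmf (\<lambda>a. if a \<in> {1..r} then \<pi> a else 0)"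

definition node_pairs :: "nat \<Rightarrow> (nat \<times> nat) set" where
  "node_pairs n = {(i, j). 1 \<le> i \<and> i < j \<and> j \<le> n}"

(* Joint law of the edge indicators (X_ij), 1 <= i < j <= n, with the node states integrated out.
   An outcome x has x (i, j) = True iff the edge {i, j} is present, for (i, j) in node_pairs n;
   outside {1..n} and node_pairs n, states and indicators are fixed to the dummy values 0 and
   False. *)
definition graph_mixture_pmf ::
    "nat \<Rightarrow> nat \<Rightarrow> (nat \<Rightarrow> real) \<Rightarrow> (nat \<Rightarrow> nat \<Rightarrow> real) \<Rightarrow> (nat \<times> nat \<Rightarrow> bool) pmf" where
  "graph_mixture_pmf r n \<pi> p =
     bind_pmf (Pi_pmf {1..n} 0 (\<lambda>_. node_state_pmf r \<pi>))
       (\<lambda>Z. Pi_pmf (node_pairs n) False (\<lambda>(i, j). bernoulli_pmf (p (Z i) (Z j))))"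

lemma finite_node_pairs [simp]: "finite (node_pairs n)"
  by (rule finite_subset[of _ "{1..n} \<times> {1..n}"]) (auto simp: node_pairs_def)

lemma pmf_node_state_pmf:
  assumes "mixture_param r \<pi> p"
  shows "pmf (node_state_pmf r \<pi>) a = (if a \<in> {1..r} then \<pi> a else 0)"
proof -
  let ?f = "\<lambda>a. if a \<in> {1..r} then \<pi> a else 0"
  have nonneg: "0 \<le> ?f x" for x
    using assms by (auto simp: mixture_param_def intro: less_imp_le)
  have "(\<integral>\<^sup>+x. ennreal (?f x) \<partial>count_space UNIV) = (\<Sum>x\<in>{1..r}. ennreal (?f x))"
    by (rule nn_integral_count_space'[of "{1..r}"]) auto
  also have "\<dots> = ennreal (\<Sum>x\<in>{1..r}. ?f x)"
    by (rule sum_ennreal) (rule nonneg)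
  also have "(\<Sum>x\<in>{1..r}. ?f x) = 1"
    using assms by (simp add: mixture_param_def)
  finally show ?thesis
    unfolding node_state_pmf_def by (subst pmf_embed_pmf) (use nonneg in auto)
qed

lemma pmf_graph_mixture_pmf:
  assumes param: "mixture_param r \<pi> p" and x: "\<And>e. e \<notin> node_pairs n \<Longrightarrow> \<not> x e"
  shows "pmf (graph_mixture_pmf r n \<pi> p) x =
    (\<Sum>z\<in>PiE_dflt {1..n} 0 (\<lambda>_. {1..r}). (\<Prod>i=1..n. \<pi> (z i)) *
       (\<Prod>(i, j)\<in>node_pairs n. if x (i, j) then p (z i) (z j) else 1 - p (z i) (z j)))"
proof -
  let ?Z = "PiE_dflt {1..n} 0 (\<lambda>_. {1..r})"
  let ?M = "Pi_pmf {1..n} 0 (\<lambda>_. node_state_pmf r \<pi>)"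
  let ?L = "\<lambda>z. Pi_pmf (node_pairs n) False (\<lambda>(i, j). bernoulli_pmf (p (z i) (z j)))"
  have fin: "finite ?Z"
    by (intro finite_PiE_dflt) auto
  have "set_pmf (node_state_pmf r \<pi>) \<subseteq> {1..r}"
    using pmf_node_state_pmf[OF param] by (auto simp: set_pmf_iff split: if_splits)
  then have sub: "set_pmf ?M \<subseteq> ?Z"
    by (subst set_Pi_pmf) (auto simp: PiE_dflt_def)
  have "pmf (graph_mixture_pmf r n \<pi> p) x = (\<Sum>z\<in>?Z. pmf ?M z * pmf (?L z) x)"
    unfolding graph_mixture_pmf_def pmf_bind
    by (subst integral_measure_pmf[OF fin]) (use sub in auto)
  also have "\<dots> = (\<Sum>z\<in>?Z. (\<Prod>i=1..n. \<pi> (z i)) *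
       (\<Prod>(i, j)\<in>node_pairs n. if x (i, j) then p (z i) (z j) else 1 - p (z i) (z j)))"
  proof (rule sum.cong[OF refl])
    fix z assume z: "z \<in> ?Z"
    have zr: "z i \<in> {1..r}" if "i \<in> {1..n}" for i
      using z that unfolding PiE_dflt_def by (auto split: if_splits)
    have z0: "z i = 0" if "i \<notin> {1..n}" for i
      using z that unfolding PiE_dflt_def by (auto split: if_splits)
    have 1: "pmf ?M z = (\<Prod>i=1..n. \<pi> (z i))"
      using zr z0 by (subst pmf_Pi') (auto intro!: prod.cong simp: pmf_node_state_pmf[OF param])
    have 2: "pmf (?L z) x =
        (\<Prod>(i, j)\<in>node_pairs n. if x (i, j) then p (z i) (z j) else 1 - p (z i) (z j))"
    proof (subst pmf_Pi')
      show "(\<Prod>e\<in>node_pairs n. pmf (case e of (i, j) \<Rightarrow> bernoulli_pmf (p (z i) (z j))) (x e)) =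
        (\<Prod>(i, j)\<in>node_pairs n. if x (i, j) then p (z i) (z j) else 1 - p (z i) (z j))"
      proof (rule prod.cong[OF refl], clarify)
        fix i j assume "(i, j) \<in> node_pairs n"
        then have "z i \<in> {1..r}" "z j \<in> {1..r}"
          using zr by (auto simp: node_pairs_def)
        then have "0 \<le> p (z i) (z j)" "p (z i) (z j) \<le> 1"
          using param by (auto simp: mixture_param_def)
        then show "pmf (bernoulli_pmf (p (z i) (z j))) (x (i, j)) =
          (if x (i, j) then p (z i) (z j) else 1 - p (z i) (z j))"
          by (cases "x (i, j)") auto
      qed
    qed (use x in auto)
    show "pmf ?M z * pmf (?L z) x = (\<Prod>i=1..n. \<pi> (z i)) *
       (\<Prod>(i, j)\<in>node_pairs n. if x (i, j) then p (z i) (z j) else 1 - p (z i) (z j))"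
      using 1 2 by simp
  qed
  finally show ?thesis .
qed

end

theory Submission
  imports Defs
begin

text \<open>
  The law of the graph determines, for every set of node pairs, the probability that all of them
  are edges. Six such probabilities, on at most four nodes, suffice. Write \<open>x, y\<close> for the state
  probabilities, \<open>a, b, c\<close> for the connection parameters \<open>p\<^sub>1\<^sub>1, p\<^sub>1\<^sub>2, p\<^sub>2\<^sub>2\<close>, and
  \<open>u = x a + y b\<close>, \<open>v = x b + y c\<close> for the conditional probabilities that a node of state 1,
  respectively 2, is joined to a given other node.

  Conditionally on the state of its centre, the edges of a star are independent, so the stars with
  one, two and three edges give the first three moments of the law that puts mass \<open>x\<close> at \<open>u\<close> and
  \<open>y\<close> at \<open>v\<close>. If \<open>u \<noteq> v\<close>, these moments determine that law, hence \<open>x, y, u, v\<close> up to exchanging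
  the two atoms (\<open>two_point_law_unique\<close>). The two linear equations for \<open>u\<close> and \<open>v\<close> leave one
  degree of freedom in \<open>(a, b, c)\<close>, and the path with three edges fixes it
  (\<open>connection_determined_by_degrees\<close>).

  If \<open>u = v = d\<close>, the two-point law has variance zero, which is visible in the moments, so every
  parameter with the same graph law is of this kind too, with the same \<open>d\<close>. Now the function 1 is an
  eigenfunction of the operator with kernel \<open>p\<close> on the two-point probability space, and \<open>p\<close> is
  \<open>d\<close> plus a kernel of rank one, \<open>p\<^sub>i\<^sub>j = d + m \<phi>\<^sub>i \<phi>\<^sub>j\<close>, where \<open>\<phi>\<close> has mean 0 and variance 1 and
  \<open>m = x (a - b)\<close>. Expanding the probability of a graph over the choice of \<open>d\<close> or
  \<open>m \<phi>\<^sub>i \<phi>\<^sub>j\<close> at each edge, only those choices survive where the second kind of edge meets no node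
  exactly once. For the triangle this leaves \<open>d\<^sup>3 + m\<^sup>3\<close>, which determines \<open>m\<close>. For the diamond (two
  triangles sharing an edge) the nodes of degree three contribute the squared third moment of \<open>\<phi>\<close>,
  namely \<open>1/(x y) - 4\<close>, multiplied by \<open>m\<^sup>5\<close> (\<open>equal_degrees_moments\<close>). As \<open>a \<noteq> b\<close> means
  \<open>m \<noteq> 0\<close>, this determines \<open>x y\<close>, hence \<open>x\<close> and \<open>y\<close> up to exchange, and then \<open>a, b, c\<close>.
\<close>

section \<open>Probability that a prescribed set of edges is present\<close>

lemma expectation_Pi_pmf_insert:
  fixes f :: "('i \<Rightarrow> 'a) \<Rightarrow> real"
  assumes "finite I" "i \<notin> I" "finite S" "set_pmf M \<subseteq> S"
  shows "measure_pmf.expectation (Pi_pmf (insert i I) dflt (\<lambda>_. M)) f =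
    (\<Sum>a\<in>S. pmf M a * measure_pmf.expectation (Pi_pmf I dflt (\<lambda>_. M)) (\<lambda>Z. f (Z(i := a))))"
proof -
  have fin: "finite (set_pmf (Pi_pmf I dflt (\<lambda>_. M)))"
    using assms by (auto simp: set_Pi_pmf intro!: finite_PiE_dflt intro: finite_subset)
  have "Pi_pmf (insert i I) dflt (\<lambda>_. M) =
      bind_pmf M (\<lambda>a. map_pmf (\<lambda>Z. Z(i := a)) (Pi_pmf I dflt (\<lambda>_. M)))"
    using assms by (simp add: Pi_pmf_insert' map_pmf_def)
  then show ?thesis
    using pmf_expectation_bind[of S "\<lambda>a. map_pmf (\<lambda>Z. Z(i := a)) (Pi_pmf I dflt (\<lambda>_. M))" M f]
      fin assms by simp
qed

lemma set_node_state_pmf: "mixture_param r \<pi> p \<Longrightarrow> set_pmf (node_state_pmf r \<pi>) \<subseteq> {1..r}"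
  by (auto simp: set_pmf_iff pmf_node_state_pmf split: if_splits)

text \<open>
  Given the node states, the event that all of \<open>E\<close> is present is a product event for the
  independent edge indicators; only the average over the states remains to be taken.
\<close>

lemma prob_edges_present:
  assumes param: "mixture_param r \<pi> p" and E: "E \<subseteq> node_pairs n"
  shows "measure_pmf.prob (graph_mixture_pmf r n \<pi> p) {x. \<forall>e\<in>E. x e} =
    measure_pmf.expectation (Pi_pmf {1..n} 0 (\<lambda>_. node_state_pmf r \<pi>))
      (\<lambda>Z. \<Prod>(i, j)\<in>E. p (Z i) (Z j))"
proof -
  let ?M = "Pi_pmf {1..n} 0 (\<lambda>_. node_state_pmf r \<pi>)"
  let ?L = "\<lambda>Z. Pi_pmf (node_pairs n) False (\<lambda>(i, j). bernoulli_pmf (p (Z i) (Z j)))"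
  let ?B = "\<lambda>e. if e \<in> E then {True} else UNIV"
  have finM: "finite (set_pmf ?M)"
    using finite_subset[OF set_node_state_pmf[OF param]]
    by (auto simp: set_Pi_pmf intro!: finite_PiE_dflt)
  have finL: "finite (set_pmf (?L Z))" for Z
    by (auto simp: set_Pi_pmf intro!: finite_PiE_dflt)
  have E_eq: "{x. \<forall>e\<in>E. x e} = Pi (node_pairs n) ?B"
    using E by (auto simp: Pi_iff split: if_splits)
  have cond: "measure_pmf.prob (?L Z) {x. \<forall>e\<in>E. x e} = (\<Prod>(i, j)\<in>E. p (Z i) (Z j))"
    if Z: "Z \<in> set_pmf ?M" for Z
  proof -
    have "Z i \<in> {1..r}" if "i \<in> {1..n}" for i
      using Z that set_node_state_pmf[OF param] by (fastforce simp: set_Pi_pmf PiE_dflt_def)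
    then have p01: "0 \<le> p (Z i) (Z j) \<and> p (Z i) (Z j) \<le> 1" if "(i, j) \<in> node_pairs n" for i j
      using that param by (auto simp: node_pairs_def mixture_param_def)
    have "measure_pmf.prob (?L Z) {x. \<forall>e\<in>E. x e} =
        (\<Prod>e\<in>node_pairs n. measure_pmf.prob (case e of (i, j) \<Rightarrow> bernoulli_pmf (p (Z i) (Z j))) (?B e))"
      unfolding E_eq by (rule measure_Pi_pmf_Pi) simp
    also have "\<dots> = (\<Prod>e\<in>node_pairs n. if e \<in> E then (case e of (i, j) \<Rightarrow> p (Z i) (Z j)) else 1)"
      using p01 by (intro prod.cong) (auto simp: measure_pmf_single)
    also have "\<dots> = (\<Prod>(i, j)\<in>E. p (Z i) (Z j))"
      using E by (simp add: prod.If_cases Int_absorb1)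
    finally show ?thesis .
  qed
  have "measure_pmf.prob (graph_mixture_pmf r n \<pi> p) {x. \<forall>e\<in>E. x e} =
      measure_pmf.expectation (bind_pmf ?M ?L) (indicator {x. \<forall>e\<in>E. x e})"
    by (simp add: graph_mixture_pmf_def)
  also have "\<dots> = (\<Sum>Z\<in>set_pmf ?M. pmf ?M Z * measure_pmf.prob (?L Z) {x. \<forall>e\<in>E. x e})"
    using finM finL by (subst pmf_expectation_bind[of "set_pmf ?M"]) auto
  also have "\<dots> = (\<Sum>Z\<in>set_pmf ?M. pmf ?M Z * (\<Prod>(i, j)\<in>E. p (Z i) (Z j)))"
    by (intro sum.cong) (simp_all add: cond)
  also have "\<dots> = measure_pmf.expectation ?M (\<lambda>Z. \<Prod>(i, j)\<in>E. p (Z i) (Z j))"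
    using finM by (subst integral_measure_pmf[of "set_pmf ?M"]) auto
  finally show ?thesis .
qed

text \<open>
  The states of the nodes above 4 do not enter the integrand, so splitting off the first four
  coordinates of the product measure turns the expectation into a finite sum whose shape does not
  depend on the number of nodes.
\<close>

lemma prob_edges_present_four_nodes:
  assumes param: "mixture_param r \<pi> p" and n: "4 \<le> n" and E: "E \<subseteq> node_pairs 4"
  shows "measure_pmf.prob (graph_mixture_pmf r n \<pi> p) {x. \<forall>e\<in>E. x e} =
    (\<Sum>a=1..r. \<pi> a * (\<Sum>b=1..r. \<pi> b * (\<Sum>c=1..r. \<pi> c * (\<Sum>d=1..r. \<pi> d *
       (\<Prod>(i, j)\<in>E. p ([a, b, c, d] ! (i - 1)) ([a, b, c, d] ! (j - 1)))))))"
proof -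
  have E_n: "E \<subseteq> node_pairs n"
    using E n by (auto simp: node_pairs_def)
  have nodes: "{1..n} = insert 1 (insert 2 (insert 3 (insert 4 {5..n})))"
    using n by auto
  have first_four: "(\<Prod>(i, j)\<in>E. p ((Z(4 := d, 3 := c, 2 := b, 1 := a)) i)
        ((Z(4 := d, 3 := c, 2 := b, 1 := a)) j)) =
      (\<Prod>(i, j)\<in>E. p ([a, b, c, d] ! (i - 1)) ([a, b, c, d] ! (j - 1)))" for Z :: "nat \<Rightarrow> nat" and a b c d
  proof (intro prod.cong refl, clarify)
    fix i j assume "(i, j) \<in> E"
    then have "i \<in> {1, 2, 3, 4}" "j \<in> {1, 2, 3, 4}"
      using E by (auto simp: node_pairs_def)
    then show "p ((Z(4 := d, 3 := c, 2 := b, 1 := a)) i) ((Z(4 := d, 3 := c, 2 := b, 1 := a)) j) =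
        p ([a, b, c, d] ! (i - 1)) ([a, b, c, d] ! (j - 1))"
      by auto
  qed
  have step: "measure_pmf.expectation (Pi_pmf (insert i I) 0 (\<lambda>_. node_state_pmf r \<pi>)) f =
      (\<Sum>a=1..r. \<pi> a * measure_pmf.expectation (Pi_pmf I 0 (\<lambda>_. node_state_pmf r \<pi>)) (\<lambda>Z. f (Z(i := a))))"
    if "finite I" "i \<notin> I" for i :: nat and I and f :: "(nat \<Rightarrow> nat) \<Rightarrow> real"
    using that
    by (subst expectation_Pi_pmf_insert[OF _ _ _ set_node_state_pmf[OF param]])
      (auto intro!: sum.cong simp: pmf_node_state_pmf[OF param])
  show ?thesis
    unfolding prob_edges_present[OF param E_n] nodes
    by (simp add: step first_four del: fun_upd_apply One_nat_def)
qed

section \<open>Probabilities of six small graphs for two node states\<close>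

text \<open>
  The six graphs are the edge, the cherry and the claw (stars with centre 1), the path with three
  edges, the triangle and the diamond. Each expression on the right conditions on the states of few
  nodes: of the centre for a star; of the nodes 1 and 2 for the others, where the remaining nodes are
  pendant neighbours (factors \<open>x a + y b\<close> and \<open>x b + y c\<close>) or common neighbours of these two (sums such as
  \<open>x a\<^sup>2 + y b\<^sup>2\<close>).
\<close>

lemma two_state_subgraph_probabilities:
  fixes \<pi> :: "nat \<Rightarrow> real" and p :: "nat \<Rightarrow> nat \<Rightarrow> real"
  assumes param: "mixture_param 2 \<pi> p" and n: "4 \<le> n"
  defines "prb \<equiv> (\<lambda>E. measure_pmf.prob (graph_mixture_pmf 2 n \<pi> p) {x. \<forall>e\<in>E. x e})"
  defines "x \<equiv> \<pi> 1" and "y \<equiv> \<pi> 2" and "a \<equiv> p 1 1" and "b \<equiv> p 1 2" and "c \<equiv> p 2 2"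
  shows "prb {(1,2)} = x * (x*a + y*b) + y * (x*b + y*c)"
    and "prb {(1,2), (1,3)} = x * (x*a + y*b)^2 + y * (x*b + y*c)^2"
    and "prb {(1,2), (1,3), (1,4)} = x * (x*a + y*b)^3 + y * (x*b + y*c)^3"
    and "prb {(1,2), (1,3), (2,4)} = x^2 * a * (x*a + y*b)^2
      + 2 * x * y * b * (x*a + y*b) * (x*b + y*c) + y^2 * c * (x*b + y*c)^2"
    and "prb {(1,2), (1,3), (2,3)} = x^2 * a * (x*a^2 + y*b^2)
      + 2 * x * y * b * (x*a*b + y*b*c) + y^2 * c * (x*b^2 + y*c^2)"
    and "prb {(1,2), (1,3), (2,3), (1,4), (2,4)} = x^2 * a * (x*a^2 + y*b^2)^2
      + 2 * x * y * b * (x*a*b + y*b*c)^2 + y^2 * c * (x*b^2 + y*c^2)^2"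
proof -
  have sum2: "(\<Sum>a=1..2. f a) = f 1 + f 2" for f :: "nat \<Rightarrow> real"
    by (simp add: numeral_2_eq_2)
  have sym: "p 2 1 = b"
    using param by (simp add: mixture_param_def b_def)
  \<comment> \<open>This removes the sums over nodes that are in none of the edges.\<close>
  have y: "y = 1 - x"
    using param by (simp add: mixture_param_def sum2 x_def y_def del: One_nat_def)
  have prb: "prb E = (\<Sum>a=1..2. \<pi> a * (\<Sum>b=1..2. \<pi> b * (\<Sum>c=1..2. \<pi> c * (\<Sum>d=1..2. \<pi> d *
       (\<Prod>(i, j)\<in>E. p ([a, b, c, d] ! (i - 1)) ([a, b, c, d] ! (j - 1)))))))"
    if "E \<subseteq> node_pairs 4" for E
    unfolding prb_def by (rule prob_edges_present_four_nodes[OF param n that])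
  note expand = sum2 sym x_def[symmetric] y_def[symmetric] a_def[symmetric] b_def[symmetric] c_def[symmetric]
  show "prb {(1,2)} = x * (x*a + y*b) + y * (x*b + y*c)"
    by (subst prb) (simp add: node_pairs_def, simp add: expand del: One_nat_def, simp add: y, algebra)
  show "prb {(1,2), (1,3)} = x * (x*a + y*b)^2 + y * (x*b + y*c)^2"
    by (subst prb) (simp add: node_pairs_def, simp add: expand del: One_nat_def, simp add: y, algebra)
  show "prb {(1,2), (1,3), (1,4)} = x * (x*a + y*b)^3 + y * (x*b + y*c)^3"
    by (subst prb) (simp add: node_pairs_def, simp add: expand del: One_nat_def, algebra)
  show "prb {(1,2), (1,3), (2,4)} = x^2 * a * (x*a + y*b)^2
      + 2 * x * y * b * (x*a + y*b) * (x*b + y*c) + y^2 * c * (x*b + y*c)^2"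
    by (subst prb) (simp add: node_pairs_def, simp add: expand del: One_nat_def, algebra)
  show "prb {(1,2), (1,3), (2,3)} = x^2 * a * (x*a^2 + y*b^2)
      + 2 * x * y * b * (x*a*b + y*b*c) + y^2 * c * (x*b^2 + y*c^2)"
    by (subst prb) (simp add: node_pairs_def, simp add: expand del: One_nat_def, simp add: y, algebra)
  show "prb {(1,2), (1,3), (2,3), (1,4), (2,4)} = x^2 * a * (x*a^2 + y*b^2)^2
      + 2 * x * y * b * (x*a*b + y*b*c)^2 + y^2 * c * (x*b^2 + y*c^2)^2"
    by (subst prb) (simp add: node_pairs_def, simp add: expand del: One_nat_def, algebra)
qed

section \<open>Recovering the parameters from the six probabilities\<close>

text \<open>
  The atoms \<open>u, v\<close> are the roots of \<open>X\<^sup>2 - (u + v) X + u v\<close>, so the moments satisfy a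
  linear recurrence of order two with the coefficients \<open>u + v\<close> and \<open>- u v\<close>. The moments of
  order 0 to 3 give two linear equations for these coefficients, with the variance \<open>x y (u - v)\<^sup>2\<close> as determinant.
\<close>

lemma two_point_law_unique:
  fixes x y u v x' y' u' v' :: real
  assumes "x + y = 1" "x' + y' = 1" "0 < x" "0 < y" "u \<noteq> v"
    and m1: "x' * u' + y' * v' = x * u + y * v"
    and m2: "x' * u'^2 + y' * v'^2 = x * u^2 + y * v^2"
    and m3: "x' * u'^3 + y' * v'^3 = x * u^3 + y * v^3"
  shows "(x' = x \<and> y' = y \<and> u' = u \<and> v' = v) \<or> (x' = y \<and> y' = x \<and> u' = v \<and> v' = u)"
proof -
  have y: "y = 1 - x" and y': "y' = 1 - x'"
    using assms by auto
  \<comment> \<open>The differences of the two pairs of coefficients solve the homogeneous system.\<close>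
  define e1 e2 where "e1 = (u' + v') - (u + v)" and "e2 = u' * v' - u * v"
  have r1: "e1 * (x * u + y * v) = e2"
    using m1 m2 unfolding e1_def e2_def y y' by algebra
  have r2: "e1 * (x * u^2 + y * v^2) = e2 * (x * u + y * v)"
    using m1 m2 m3 unfolding e1_def e2_def y y' by algebra
  have "e1 * (x * y * (u - v)^2)
      = e1 * (x * u^2 + y * v^2) - e1 * (x * u + y * v) * (x * u + y * v)"
    unfolding y by algebra
  also have "\<dots> = 0"
    unfolding r1 r2 by simp
  finally have "e1 * (x * y * (u - v)^2) = 0" .
  then have e1: "e1 = 0"
    using assms by simp
  then have e2: "e2 = 0"
    using r1 by simp
  have v': "v' = u + v - u'"
    using e1 by (simp add: e1_def)
  have "(u' - u) * (u' - v) = 0"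
    using e1 e2 unfolding e1_def e2_def by algebra
  then consider "u' = u" "v' = v" | "u' = v" "v' = u"
    using v' by auto
  then show ?thesis
  proof cases
    case 1
    then have "(x' - x) * (u - v) = 0"
      using m1 unfolding y y' by (simp add: algebra_simps)
    then show ?thesis
      using 1 \<open>u \<noteq> v\<close> y y' by simp
  next
    case 2
    then have "(x' - y) * (u - v) = 0"
      using m1 unfolding y y' by (simp add: algebra_simps)
    then show ?thesis
      using 2 \<open>u \<noteq> v\<close> y y' by simp
  qed
qed

text \<open>
  With the degrees \<open>u\<close> and \<open>v\<close> fixed, \<open>a\<close> and \<open>c\<close> are affine functions of \<open>b\<close>, and hence so is the
  path probability. Its slope is a multiple of \<open>(u - v)\<^sup>2\<close>.
\<close>

lemma path_moment:
  fixes x y a b c u v :: real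
  assumes "u = x*a + y*b" "v = x*b + y*c"
  shows "x^2 * a * u^2 + 2 * x * y * b * u * v + y^2 * c * v^2
    = x * u^3 + y * v^3 - x * y * b * (u - v)^2"
  using assms by algebra

lemma connection_determined_by_degrees:
  fixes x y a b c a' b' c' u v :: real
  assumes "0 < x" "0 < y" "u \<noteq> v"
    and deg: "u = x*a + y*b" "v = x*b + y*c" and deg': "u = x*a' + y*b'" "v = x*b' + y*c'"
    and path: "x^2 * a' * u^2 + 2 * x * y * b' * u * v + y^2 * c' * v^2
      = x^2 * a * u^2 + 2 * x * y * b * u * v + y^2 * c * v^2"
  shows "a' = a \<and> b' = b \<and> c' = c"
proof -
  have "x * y * (u - v)^2 * (b' - b) = 0"
    using path unfolding path_moment[OF deg] path_moment[OF deg'] by algebra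
  then have b: "b' = b"
    using assms by simp
  then have "x * a' = x * a" "y * c' = y * c"
    using deg deg' by auto
  then show ?thesis
    using b assms by simp
qed

text \<open>
  The first three equations are the decomposition \<open>d + m \<phi>\<^sub>i \<phi>\<^sub>j\<close> with
  \<open>\<phi> = (sqrt (y/x), - sqrt (x/y))\<close>, which avoids square roots because only products of two values
  of \<open>\<phi>\<close> occur. In the triangle, only the full triangle contributes besides the constant term. In
  the diamond the surviving subgraphs are its two triangles (\<open>2 d\<^sup>2 m\<^sup>3\<close>), its four-cycle
  (\<open>d m\<^sup>4\<close>) and the whole diamond.
\<close>

lemma equal_degrees_moments:
  fixes x y a b c d :: real
  assumes xy: "x + y = 1" "0 < x" "0 < y" and deg: "x*a + y*b = d" "x*b + y*c = d"
  defines "m \<equiv> x * (a - b)"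
  shows "a = d + m * y / x" "b = d - m" "c = d + m * x / y"
    and "x^2 * a * (x*a^2 + y*b^2) + 2 * x * y * b * (x*a*b + y*b*c)
      + y^2 * c * (x*b^2 + y*c^2) = d^3 + m^3"
    and "x^2 * a * (x*a^2 + y*b^2)^2 + 2 * x * y * b * (x*a*b + y*b*c)^2
      + y^2 * c * (x*b^2 + y*c^2)^2 = d^5 + 2 * d^2 * m^3 + d * m^4 + m^5 * (1 / (x * y) - 4)"
proof -
  \<comment> \<open>The rescaling \<open>m = x y t\<close> makes all connection parameters polynomials in \<open>x, y, t, d\<close>.\<close>
  define t where "t = (a - b) / y"
  have y: "y = 1 - x"
    using xy by simp
  have m: "m = x * y * t"
    using xy by (simp add: t_def m_def)
  have b: "b = d - m"
    using deg(1) unfolding m_def y by (simp add: algebra_simps)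
  have a: "a = d + y^2 * t"
  proof -
    have "a = b + y * t"
      using xy by (simp add: t_def)
    then show ?thesis
      unfolding b m y by algebra
  qed
  have c: "c = d + x^2 * t"
  proof -
    have "y * c = y * (d + x^2 * t)"
      using deg(2) unfolding b m y by (simp add: algebra_simps power2_eq_square)
    then show ?thesis
      using xy by simp
  qed
  show "a = d + m * y / x" "b = d - m" "c = d + m * x / y"
    using xy a b c by (simp_all add: m power2_eq_square)
  \<comment> \<open>The probability that a third node is joined to both of two nodes is the composed kernel
    \<open>d\<^sup>2 + m\<^sup>2 \<phi>\<^sub>i \<phi>\<^sub>j\<close>.\<close>
  have k11: "x*a^2 + y*b^2 = d^2 + x * y^3 * t^2"
    unfolding a b m y by algebra
  have k12: "x*a*b + y*b*c = d^2 - x^2 * y^2 * t^2"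
    unfolding a b c m y by algebra
  have k22: "x*b^2 + y*c^2 = d^2 + x^3 * y * t^2"
    unfolding c b m y by algebra
  show "x^2 * a * (x*a^2 + y*b^2) + 2 * x * y * b * (x*a*b + y*b*c)
      + y^2 * c * (x*b^2 + y*c^2) = d^3 + m^3"
    unfolding k11 k12 k22 unfolding a b c m y by algebra
  have "m^5 * (1 / (x * y) - 4) = (x * y)^4 * t^5 * (1 - 4 * x * y)"
    using xy by (simp add: m field_simps power_eq_if)
  then show "x^2 * a * (x*a^2 + y*b^2)^2 + 2 * x * y * b * (x*a*b + y*b*c)^2
      + y^2 * c * (x*b^2 + y*c^2)^2 = d^5 + 2 * d^2 * m^3 + d * m^4 + m^5 * (1 / (x * y) - 4)"
    unfolding k11 k12 k22 unfolding a b c m y by algebra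
qed

text \<open>
  The hypotheses compare the six graph probabilities of the two parameters. If the degrees \<open>u\<close> and
  \<open>v\<close> differ, the stars and the path decide. If they coincide, then edge and cherry transfer this to
  the second parameter, and triangle and diamond decide.
\<close>

lemma two_state_parameters_unique:
  fixes x y a b c x' y' a' b' c' :: real
  defines "u \<equiv> x*a + y*b" and "v \<equiv> x*b + y*c" and "u' \<equiv> x'*a' + y'*b'" and "v' \<equiv> x'*b' + y'*c'"
  assumes xy: "x + y = 1" "0 < x" "0 < y" and xy': "x' + y' = 1" "0 < x'" "0 < y'" and "a \<noteq> b"
    and edge: "x' * u' + y' * v' = x * u + y * v"
    and cherry: "x' * u'^2 + y' * v'^2 = x * u^2 + y * v^2"
    and claw: "x' * u'^3 + y' * v'^3 = x * u^3 + y * v^3"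
    and path: "x'^2 * a' * u'^2 + 2 * x' * y' * b' * u' * v' + y'^2 * c' * v'^2
      = x^2 * a * u^2 + 2 * x * y * b * u * v + y^2 * c * v^2"
    and triangle: "x'^2 * a' * (x'*a'^2 + y'*b'^2) + 2 * x' * y' * b' * (x'*a'*b' + y'*b'*c')
        + y'^2 * c' * (x'*b'^2 + y'*c'^2)
      = x^2 * a * (x*a^2 + y*b^2) + 2 * x * y * b * (x*a*b + y*b*c) + y^2 * c * (x*b^2 + y*c^2)"
    and diamond: "x'^2 * a' * (x'*a'^2 + y'*b'^2)^2 + 2 * x' * y' * b' * (x'*a'*b' + y'*b'*c')^2
        + y'^2 * c' * (x'*b'^2 + y'*c'^2)^2
      = x^2 * a * (x*a^2 + y*b^2)^2 + 2 * x * y * b * (x*a*b + y*b*c)^2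
        + y^2 * c * (x*b^2 + y*c^2)^2"
  shows "(x', y', a', b', c') = (x, y, a, b, c) \<or> (x', y', a', b', c') = (y, x, c, b, a)"
proof (cases "u = v")
  case False
  then consider (same) "x' = x" "y' = y" "u' = u" "v' = v" | (swap) "x' = y" "y' = x" "u' = v" "v' = u"
    using two_point_law_unique[OF xy(1) xy'(1) xy(2,3) _ edge cherry claw] by blast
  then show ?thesis
  proof cases
    case same
    have "a' = a \<and> b' = b \<and> c' = c"
      by (rule connection_determined_by_degrees[OF xy(2,3) False])
        (use same path in \<open>simp_all add: u_def v_def u'_def v'_def\<close>)
    then show ?thesis
      using same by simp
  next
    case swap
    have "c' = a \<and> b' = b \<and> a' = c"
      by (rule connection_determined_by_degrees[OF xy(2,3) False])
        (use swap path in \<open>simp_all add: u_def v_def u'_def v'_def algebra_simps\<close>)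
    then show ?thesis
      using swap by simp
  qed
next
  case True
  \<comment> \<open>The variance of the degree is a function of the edge and cherry probabilities, so it also
    vanishes for the second parameter.\<close>
  have "x' * y' * (u' - v')^2 = 0"
  proof -
    have "x' * y' * (u' - v')^2 = (x' * u'^2 + y' * v'^2) - (x' * u' + y' * v')^2"
      using xy'(1) by algebra
    also have "\<dots> = 0"
      unfolding edge cherry using xy(1) True by algebra
    finally show ?thesis .
  qed
  then have eq': "u' = v'"
    using xy' by simp
  have d: "u' = u"
    using edge xy(1) xy'(1) unfolding eq' True by algebra
  define m m' where "m = x * (a - b)" and "m' = x' * (a' - b')"
  have deg: "x*a + y*b = u" "x*b + y*c = u" and deg': "x'*a' + y'*b' = u" "x'*b' + y'*c' = u"
    using True d eq' by (simp_all add: u_def v_def u'_def v'_def)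
  note M = equal_degrees_moments[OF xy deg, folded m_def]
  note M' = equal_degrees_moments[OF xy' deg', folded m'_def]
  have "m' ^ 3 = m ^ 3"
    using triangle unfolding M(4) M'(4) by simp
  then have m: "m' = m"
    using odd_real_root_power_cancel[of 3 m] odd_real_root_power_cancel[of 3 m'] by simp
  have m0: "m \<noteq> 0"
    using xy \<open>a \<noteq> b\<close> by (simp add: m_def)
  have "1 / (x' * y') = 1 / (x * y)"
    using diamond m0 unfolding M(5) M'(5) m by simp
  then have prod: "x' * y' = x * y"
    using xy xy' by simp
  have "(x' - x) * (x' - y) = 0"
    using prod xy(1) xy'(1) by algebra
  then consider "x' = x" "y' = y" | "x' = y" "y' = x"
    using xy(1) xy'(1) by auto
  then show ?thesis
    using M(1-3) M'(1-3) m by cases simp_all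
qed

theorem theorem7:
  fixes n :: nat and \<pi> \<pi>' :: "nat \<Rightarrow> real" and p p' :: "nat \<Rightarrow> nat \<Rightarrow> real"
  assumes "n \<ge> 16"
    and "mixture_param 2 \<pi> p"
    and "mixture_param 2 \<pi>' p'"
    and "p 1 1 \<noteq> p 1 2" and "p 1 1 \<noteq> p 2 2" and "p 1 2 \<noteq> p 2 2"
    and "graph_mixture_pmf 2 n \<pi>' p' = graph_mixture_pmf 2 n \<pi> p"
  shows "(\<pi>' 1, \<pi>' 2, p' 1 1, p' 1 2, p' 2 2) = (\<pi> 1, \<pi> 2, p 1 1, p 1 2, p 2 2) \<or>
         (\<pi>' 1, \<pi>' 2, p' 1 1, p' 1 2, p' 2 2) = (\<pi> 2, \<pi> 1, p 2 2, p 1 2, p 1 1)"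
proof -
  have n: "4 \<le> n"
    using \<open>n \<ge> 16\<close> by simp
  have xy: "\<rho> 1 + \<rho> 2 = 1" "0 < \<rho> 1" "0 < \<rho> 2" if "mixture_param 2 \<rho> q" for \<rho> q
    using that by (simp_all add: mixture_param_def numeral_2_eq_2)
  note K = two_state_subgraph_probabilities[OF assms(2) n]
  note K' = two_state_subgraph_probabilities[OF assms(3) n, unfolded assms(7)]
  show ?thesis
    by (rule two_state_parameters_unique[OF xy[OF assms(2)] xy[OF assms(3)] assms(4)])
      (rule trans[OF K'(1)[symmetric] K(1)] trans[OF K'(2)[symmetric] K(2)]
        trans[OF K'(3)[symmetric] K(3)] trans[OF K'(4)[symmetric] K(4)]
        trans[OF K'(5)[symmetric] K(5)] trans[OF K'(6)[symmetric] K(6)])+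
qed

end
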